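(* Let $\theta_0\in(0,\pi)$ and $\Omega=\{(r,\theta,\varphi): r>0,\ 0\le\theta<\theta_0,\ \varphi\in[0,2\pi)\}\subset\mathbb{R}^3$, with boundary $\Gamma_{\mathrm{cone}}=\{r>0,\ \theta=\theta_0\}$. Consider the oblique derivative problem with axi-symmetric oblique vector $$\Delta u=0\ \text{ in }\Omega,\qquad \beta\cdot Du=0\ \text{ on }\Gamma_{\mathrm{cone}},\qquad(\ast)$$ where, in the cylindrical symmetry coordinates $(y_1,y_2)$, $\beta=(\cos(s),\sin(s))$ with $s\in(-\pi+\theta_0,\theta_0)$. (1) Suppose $\theta_0\in(\frac{\pi}{2},\pi)$. Then there exists $s_0\in(-\pi+\theta_0,0)$ such that if either $s\in(-\pi+\theta_0,s_0)$ or $s\in(\frac{\pi}{2},\theta_0)$, then there exists $\alpha=\alpha(\theta_0,s)\in(0,1)$ such that $$u(r,\theta)=r^\alpha\,\mathrm{P}_\alpha(\cos\theta)$$ is an axi-symmetric solution of $(\ast)$ that lies in $C^{0,\alpha}\setminus C^{0,\alpha+\epsilon}$ for any $\epsilon>0$. (2) Suppose $\theta_0\in(0,\frac{\pi}{2})$. Then there exists $s_0\in(-\frac{\pi}{2},0)$ such that if $s\in(-\frac{\pi}{2},s_0)$, then there exists $\alpha=\alpha(\theta_0,s)\in(0,1)$ such that $$u(r,\theta)=r^\alpha\,\mathrm{P}_\alpha(\cos\theta)$$ is an axi-symmetric solution of $(\ast)$ that lies in $C^{0,\alpha}\setminus C^{0,\alpha+\epsilon}$ for any $\epsilon>0$.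
   Context: $(r,\theta,\varphi)$ are standard spherical coordinates in $\mathbb{R}^3$, with $\theta$ the angle from the positive $x_3$ axis: $x_3=r\cos\theta$, $\sqrt{x_1^2+x_2^2}=r\sin\theta$. The symmetry coordinates are $y_1=r\cos\theta$, $y_2=r\sin\theta$; a function is axi-symmetric if it depends only on $(y_1,y_2)$, and then $\beta\cdot Du=\cos(s)\,\partial_{y_1}u+\sin(s)\,\partial_{y_2}u$. $\mathrm{P}_\alpha$ is the Legendre function of the first kind of (real) degree $\alpha$ on $(-1,1]$, $\mathrm{P}_\alpha(z)={}_2F_1(-\alpha,\alpha+1;1;\frac{1-z}{2})$, normalized by $\mathrm{P}_\alpha(1)=1$. The H\"older classes $C^{0,\alpha}$, $C^{0,\alpha+\epsilon}$ refer to H\"older regularity up to the boundary, including the vertex $0$ (on bounded parts of $\overline\Omega$ containing the vertex). *)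

theory Defs
  imports "HOL-Analysis.Analysis"
begin

definition hypergeometric_2F1 :: "real \<Rightarrow> real \<Rightarrow> real \<Rightarrow> real \<Rightarrow> real" where
  "hypergeometric_2F1 a b c z = eval_fps (fps_hypergeo [a, b] [c] 1) z"

(* The series converges for z in (-1,3), which contains (-1,1], the only arguments of interest. *)
definition Legendre_P :: "real \<Rightarrow> real \<Rightarrow> real" where
  "Legendre_P a z = hypergeometric_2F1 (- a) (a + 1) 1 ((1 - z) / 2)"

definition spherical_point :: "real \<Rightarrow> real \<Rightarrow> real \<Rightarrow> real^3" where
  "spherical_point r \<theta> \<phi> = vector [r * sin \<theta> * cos \<phi>, r * sin \<theta> * sin \<phi>, r * cos \<theta>]"

definition cone_domain :: "real \<Rightarrow> (real^3) set" where
  "cone_domain \<theta>0 =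
     {spherical_point r \<theta> \<phi> | r \<theta> \<phi>. 0 < r \<and> 0 \<le> \<theta> \<and> \<theta> < \<theta>0 \<and> 0 \<le> \<phi> \<and> \<phi> < 2 * pi}"

(* The vertex is not included. *)
definition cone_boundary :: "real \<Rightarrow> (real^3) set" where
  "cone_boundary \<theta>0 = {spherical_point r \<theta>0 \<phi> | r \<phi>. 0 < r \<and> 0 \<le> \<phi> \<and> \<phi> < 2 * pi}"

definition y1 :: "real^3 \<Rightarrow> real" where
  "y1 x = x $ 3"

definition y2 :: "real^3 \<Rightarrow> real" where
  "y2 x = sqrt ((x $ 1)\<^sup>2 + (x $ 2)\<^sup>2)"

definition axisymmetric_on :: "(real^3) set \<Rightarrow> (real^3 \<Rightarrow> real) \<Rightarrow> bool" where
  "axisymmetric_on S u \<longleftrightarrow> (\<exists>U :: real \<Rightarrow> real \<Rightarrow> real. \<forall>x\<in>S. u x = U (y1 x) (y2 x))"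

(* The function with spherical-coordinate expression w r \<theta>.  At the vertex, where the polar angle
   is undefined, the conventions x / 0 = 0 and arccos 0 = pi / 2 give the value w 0 (pi / 2). *)
definition of_spherical :: "(real \<Rightarrow> real \<Rightarrow> real) \<Rightarrow> real^3 \<Rightarrow> real" where
  "of_spherical w x = w (norm x) (arccos (x $ 3 / norm x))"

(* The vector with components (cos s, sin s) in the (y1,y2)-coordinates: with e_1, e_2, e_3 the
   standard basis it is cos s * e_3 + sin s * (x_1 e_1 + x_2 e_2) / y2, for x off the axis. *)
definition oblique_vector :: "real \<Rightarrow> real^3 \<Rightarrow> real^3" where
  "oblique_vector s x = vector [sin s * (x $ 1 / y2 x), sin s * (x $ 2 / y2 x), cos s]"

(* Classical solutions, u in C^2(\<Omega>) and in C^1(\<Omega> \<union> \<Gamma>), with gradient Du and Hessian D2u, so that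
   the Laplacian is the trace of D2u.  On \<Gamma> the gradient is the one-sided gradient from \<Omega> \<union> \<Gamma>. *)
definition oblique_harmonic ::
    "(real^3) set \<Rightarrow> (real^3) set \<Rightarrow> (real^3 \<Rightarrow> real^3) \<Rightarrow> (real^3 \<Rightarrow> real) \<Rightarrow> bool" where
  "oblique_harmonic \<Omega> \<Gamma> \<beta> u \<longleftrightarrow>
     (\<exists>(Du :: real^3 \<Rightarrow> real^3) (D2u :: real^3 \<Rightarrow> real^3^3).
        (\<forall>x\<in>\<Omega> \<union> \<Gamma>. (u has_derivative (\<lambda>h. Du x \<bullet> h)) (at x within \<Omega> \<union> \<Gamma>)) \<and>
        continuous_on (\<Omega> \<union> \<Gamma>) Du \<and>
        (\<forall>x\<in>\<Omega>. (Du has_derivative (\<lambda>h. D2u x *v h)) (at x)) \<and>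
        continuous_on \<Omega> D2u \<and>
        (\<forall>x\<in>\<Omega>. trace (D2u x) = 0) \<and>
        (\<forall>x\<in>\<Gamma>. \<beta> x \<bullet> Du x = 0))"

(* On bounded sets, a finite seminorm implies boundedness.  For exponents a > 1 this is the same
   difference-quotient condition. *)
definition holder_on :: "real \<Rightarrow> 'a::metric_space set \<Rightarrow> ('a \<Rightarrow> real) \<Rightarrow> bool" where
  "holder_on a S u \<longleftrightarrow> (\<exists>C. \<forall>x\<in>S. \<forall>y\<in>S. \<bar>u x - u y\<bar> \<le> C * dist x y powr a)"

(* u is in C^{0,a} but in no C^{0,a+\<epsilon>} on every truncation, at any radius R > 0 about the vertex 0,
   of the closed set S. *)
definition sharp_holder_at_vertex :: "real \<Rightarrow> (real^3) set \<Rightarrow> (real^3 \<Rightarrow> real) \<Rightarrow> bool" where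
  "sharp_holder_at_vertex a S u \<longleftrightarrow>
     (\<forall>R>0. holder_on a (S \<inter> cball 0 R) u \<and>
            (\<forall>\<epsilon>>0. \<not> holder_on (a + \<epsilon>) (S \<inter> cball 0 R) u))"

definition sharp_axisymmetric_solution :: "real \<Rightarrow> real \<Rightarrow> real \<Rightarrow> (real^3 \<Rightarrow> real) \<Rightarrow> bool" where
  "sharp_axisymmetric_solution \<theta>0 s a u \<longleftrightarrow>
     axisymmetric_on (closure (cone_domain \<theta>0)) u \<and>
     oblique_harmonic (cone_domain \<theta>0) (cone_boundary \<theta>0) (oblique_vector s) u \<and>
     sharp_holder_at_vertex a (closure (cone_domain \<theta>0)) u"

end

theory Submission
  imports Defs
begin

text \<open>
  The function \<open>u = r\<^sup>\<alpha> P\<^sub>\<alpha>(cos \<theta>)\<close> is harmonic by Legendre's equation, and on the cone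
  \<open>\<theta> = \<theta>\<^sub>0\<close> the boundary condition becomes \<open>G(\<alpha>) = 0\<close> with
  \<open>G(\<alpha>) = \<alpha> cos(\<theta>\<^sub>0 - s) P\<^sub>\<alpha>(cos \<theta>\<^sub>0) + sin(\<theta>\<^sub>0 - s) sin \<theta>\<^sub>0 P\<^sub>\<alpha>'(cos \<theta>\<^sub>0)\<close>.
  The trivial zero at \<open>\<alpha> = 0\<close> is divided out coefficientwise in the hypergeometric series, so that
  \<open>K(\<alpha>) = G(\<alpha>) / \<alpha>\<close> is continuous on \<open>[0, 1]\<close>, with \<open>K(0) = cos(\<theta>\<^sub>0/2 - s) / cos(\<theta>\<^sub>0/2)\<close> and
  \<open>K(1) = cos s\<close>.  The intermediate value theorem gives \<open>\<alpha>\<close> when these two have opposite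
  signs, which leads to \<open>s\<^sub>0 = \<theta>\<^sub>0/2 - \<pi>/2\<close>.  The Hoelder exponent is exactly \<open>\<alpha>\<close> because \<open>u\<close> is
  homogeneous of degree \<open>\<alpha>\<close>, Lipschitz in \<open>cos \<theta>\<close>, and equal to \<open>t\<^sup>\<alpha>\<close> at the point \<open>t\<close> of the axis.
\<close>

subsection \<open>Legendre functions of degree between 0 and 1\<close>

definition legendre_fps :: "real \<Rightarrow> real fps" where
  "legendre_fps a = fps_hypergeo [- a, a + 1] [1] 1"

lemma legendre_fps_nth_0 [simp]: "fps_nth (legendre_fps a) 0 = 1"
  by (simp add: legendre_fps_def)

lemma legendre_fps_nth_Suc:
  "fps_nth (legendre_fps a) (Suc n) = (real n - a) * (real n + 1 + a) / (real n + 1)\<^sup>2 * fps_nth (legendre_fps a) n"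
  unfolding legendre_fps_def fps_hypergeo_rec by (simp add: power2_eq_square add_ac)

text \<open>The first factor \<open>real n - a\<close> of the hypergeometric recurrence is
  \<open>- a\<close> at \<open>n = 0\<close>, so every later coefficient contains it. These are the
  coefficients with that factor removed; they do not vanish at \<open>a = 0\<close>, which is what
  allows the trivial zero of the boundary condition to be divided out.\<close>

primrec legendre_coeff :: "real \<Rightarrow> nat \<Rightarrow> real" where
  "legendre_coeff a 0 = 1 + a"
| "legendre_coeff a (Suc n) =
     (real n + 1 - a) * (real n + 2 + a) / (real n + 2)\<^sup>2 * legendre_coeff a n"

lemma legendre_fps_nth_Suc_coeff: "fps_nth (legendre_fps a) (Suc n) = - a * legendre_coeff a n"
proof (induction n)
  case 0
  show ?case by (simp add: legendre_fps_nth_Suc)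
next
  case (Suc n)
  then show ?case by (subst legendre_fps_nth_Suc) (simp add: add_ac)
qed

text \<open>For \<open>a\<close> in [0, 1] the ratio of consecutive coefficients lies in [0, 1], and
  the first one is \<open>1 + a\<close>. The bound is uniform in \<open>a\<close>, so it also yields
  majorants for continuity in \<open>a\<close>.\<close>

lemma legendre_coeff_bounds:
  assumes "0 \<le> a" "a \<le> 1"
  shows "0 \<le> legendre_coeff a n \<and> legendre_coeff a n \<le> 2"
proof (induction n)
  case 0
  then show ?case using assms by simp
next
  case (Suc n)
  let ?q = "(real n + 1 - a) * (real n + 2 + a) / (real n + 2)\<^sup>2"
  have "0 \<le> ?q" using assms by simp
  moreover have "?q \<le> 1"
  proof -
    have "(real n + 1 - a) * (real n + 2 + a) = (real n + 1) * (real n + 2) - a - a\<^sup>2"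
      by (simp add: algebra_simps power2_eq_square)
    also have "\<dots> \<le> (real n + 2)\<^sup>2"
      using assms by (simp add: algebra_simps power2_eq_square add_increasing)
    finally show ?thesis by simp
  qed
  ultimately have "0 \<le> ?q * legendre_coeff a n" "?q * legendre_coeff a n \<le> 1 * 2"
    using Suc by (blast intro: mult_nonneg_nonneg mult_mono zero_le_one)+
  then show ?case by simp
qed

lemma legendre_coeff_at_0: "legendre_coeff 0 n = 1 / (real n + 1)"
proof (induction n)
  case (Suc n)
  then show ?case
    by (simp add: power2_eq_square)
qed simp

text \<open>The ratio vanishes at \<open>n = 0\<close> when \<open>a = 1\<close>, so the series
  terminates. This reflects P_1(z) = z.\<close>

lemma legendre_coeff_at_1: "legendre_coeff 1 n = (if n = 0 then 2 else 0)"
proof (induction n)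
  case (Suc n)
  then show ?case by (cases n) auto
qed simp

lemma continuous_on_legendre_coeff: "continuous_on A (\<lambda>a. legendre_coeff a n)"
  by (induction n) (auto intro!: continuous_intros)

lemma fps_conv_radius_legendre:
  assumes "0 \<le> a" "a \<le> 1"
  shows "1 \<le> fps_conv_radius (legendre_fps a)"
  unfolding fps_conv_radius_def
proof (rule conv_radius_geI_ex')
  fix r :: real assume r: "0 < r" "ereal r < 1"
  have "\<bar>fps_nth (legendre_fps a) n\<bar> \<le> 2" for n
  proof (cases n)
    case (Suc m)
    have "a * legendre_coeff a m \<le> 1 * 2"
      using legendre_coeff_bounds[OF assms, of m] assms by (intro mult_mono) auto
    then show ?thesis
      using legendre_coeff_bounds[OF assms, of m] assms
      by (simp add: Suc legendre_fps_nth_Suc_coeff abs_mult)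
  qed simp
  then have "norm (fps_nth (legendre_fps a) n * of_real r ^ n) \<le> 2 * r ^ n" for n
    using r by (simp add: abs_mult mult_right_mono)
  then show "summable (\<lambda>n. fps_nth (legendre_fps a) n * of_real r ^ n)"
    by (rule summable_comparison_test'[rotated]) (use r in \<open>auto intro: summable_geometric\<close>)
qed

section \<open>Legendre's differential equation\<close>

text \<open>This is the hypergeometric equation x (1 - x) f'' + (1 - 2 x) f' + a (a + 1) f = 0 for
  formal series. Multiplication by \<open>fps_X\<close> shifts indices, so comparing coefficients
  gives back the recurrence.\<close>

lemma legendre_fps_ode:
  fixes a defines "f \<equiv> legendre_fps a"
  shows "fps_X * fps_deriv (fps_deriv f) - fps_X * (fps_X * fps_deriv (fps_deriv f)) + fps_deriv f
    - 2 * (fps_X * fps_deriv f) + fps_const (a * (a + 1)) * f = 0"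
proof (rule fps_ext)
  fix n
  let ?G = "fps_X * fps_deriv (fps_deriv f) - fps_X * (fps_X * fps_deriv (fps_deriv f)) + fps_deriv f
    - 2 * (fps_X * fps_deriv f) + fps_const (a * (a + 1)) * f"
  have rec: "fps_nth f (Suc n) = (real n - a) * (real n + 1 + a) / (real n + 1)\<^sup>2 * fps_nth f n"
    by (simp only: f_def legendre_fps_nth_Suc)
  \<comment> \<open>The right side vanishes by \<open>rec\<close>, since n (n + 1) - a (a + 1) = (n
    - a) (n + 1 + a).\<close>
  have "fps_nth ?G n = (real n + 1)\<^sup>2 * fps_nth f (Suc n) - (real n * (real n + 1) - a * (a + 1)) * fps_nth f n"
  proof (cases n)
    case 0
    then show ?thesis by (simp add: numeral_fps_const algebra_simps)
  next
    case (Suc m)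
    then show ?thesis
      by (cases m) (simp_all add: numeral_fps_const algebra_simps power2_eq_square)
  qed
  also have "\<dots> = 0"
    by (simp add: rec divide_simps) (simp add: algebra_simps power2_eq_square)
  finally show "fps_nth ?G n = fps_nth 0 n" by simp
qed

lemma legendre_ode:
  assumes "0 \<le> a" "a \<le> 1" "\<bar>x\<bar> < 1"
  defines "f \<equiv> legendre_fps a"
  shows "x * (1 - x) * eval_fps (fps_deriv (fps_deriv f)) x + (1 - 2 * x) * eval_fps (fps_deriv f) x
    + a * (a + 1) * eval_fps f x = 0"
proof -
  have 0: "ereal \<bar>x\<bar> < fps_conv_radius f"
    unfolding f_def using assms(3)
    by (intro less_le_trans[OF _ fps_conv_radius_legendre[OF assms(1,2)]]) simp
  have 1: "ereal \<bar>x\<bar> < fps_conv_radius (fps_deriv f)"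
    by (rule less_le_trans[OF 0 fps_conv_radius_deriv])
  have 2: "ereal \<bar>x\<bar> < fps_conv_radius (fps_deriv (fps_deriv f))"
    by (rule less_le_trans[OF 1 fps_conv_radius_deriv])
  \<comment> \<open>\<open>eval_fps\<close> respects products, differences and sums at points inside
    both radii of convergence; \<open>m\<close>, \<open>d\<close> and \<open>p\<close> propagate
    this condition through the compound series.\<close>
  have m: "ereal \<bar>x\<bar> < fps_conv_radius (p * q)"
    if "ereal \<bar>x\<bar> < fps_conv_radius p" "ereal \<bar>x\<bar> < fps_conv_radius q" for p q :: "real fps"
    by (rule less_le_trans[OF _ fps_conv_radius_mult]) (use that in simp)
  have d: "ereal \<bar>x\<bar> < fps_conv_radius (p - q)"
    if "ereal \<bar>x\<bar> < fps_conv_radius p" "ereal \<bar>x\<bar> < fps_conv_radius q" for p q :: "real fps"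
    by (rule less_le_trans[OF _ fps_conv_radius_diff]) (use that in simp)
  have p: "ereal \<bar>x\<bar> < fps_conv_radius (p + q)"
    if "ereal \<bar>x\<bar> < fps_conv_radius p" "ereal \<bar>x\<bar> < fps_conv_radius q" for p q :: "real fps"
    by (rule less_le_trans[OF _ fps_conv_radius_add]) (use that in simp)
  have "0 = eval_fps (fps_X * fps_deriv (fps_deriv f) - fps_X * (fps_X * fps_deriv (fps_deriv f))
    + fps_deriv f - 2 * (fps_X * fps_deriv f) + fps_const (a * (a + 1)) * f) x"
    unfolding f_def legendre_fps_ode by simp
  also have "\<dots> = x * eval_fps (fps_deriv (fps_deriv f)) x
      - x * (x * eval_fps (fps_deriv (fps_deriv f)) x) + eval_fps (fps_deriv f) x
      - 2 * (x * eval_fps (fps_deriv f) x) + a * (a + 1) * eval_fps f x"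
    by (simp add: eval_fps_add eval_fps_diff eval_fps_mult m d p 0 1 2)
  finally show ?thesis by (simp add: algebra_simps)
qed

definition Legendre_P' :: "real \<Rightarrow> real \<Rightarrow> real" where
  "Legendre_P' a z = - eval_fps (fps_deriv (legendre_fps a)) ((1 - z) / 2) / 2"

definition Legendre_P'' :: "real \<Rightarrow> real \<Rightarrow> real" where
  "Legendre_P'' a z = eval_fps (fps_deriv (fps_deriv (legendre_fps a))) ((1 - z) / 2) / 4"

lemma Legendre_P_eq: "Legendre_P a z = eval_fps (legendre_fps a) ((1 - z) / 2)"
  by (simp add: Legendre_P_def hypergeometric_2F1_def legendre_fps_def)

lemma Legendre_P_1 [simp]: "Legendre_P a 1 = 1"
  by (simp add: Legendre_P_eq eval_fps_at_0)

context
  fixes a z :: real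
  assumes a: "0 \<le> a" "a \<le> 1" and z: "-1 < z" "z \<le> 1"
begin

lemma legendre_conv_radius:
  "ereal \<bar>(1 - z) / 2\<bar> < fps_conv_radius (legendre_fps a)"
  "ereal \<bar>(1 - z) / 2\<bar> < fps_conv_radius (fps_deriv (legendre_fps a))"
  "ereal \<bar>(1 - z) / 2\<bar> < fps_conv_radius (fps_deriv (fps_deriv (legendre_fps a)))"
proof -
  have "\<bar>(1 - z) / 2\<bar> < 1" using z by simp
  then show "ereal \<bar>(1 - z) / 2\<bar> < fps_conv_radius (legendre_fps a)"
    by (intro less_le_trans[OF _ fps_conv_radius_legendre[OF a]]) simp
  then show "ereal \<bar>(1 - z) / 2\<bar> < fps_conv_radius (fps_deriv (legendre_fps a))"
    by (rule less_le_trans[OF _ fps_conv_radius_deriv])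
  then show "ereal \<bar>(1 - z) / 2\<bar> < fps_conv_radius (fps_deriv (fps_deriv (legendre_fps a)))"
    by (rule less_le_trans[OF _ fps_conv_radius_deriv])
qed

text \<open>The derivative is two-sided even at \<open>z = 1\<close>, the axis of the cone, because
  this corresponds to the centre of the disc of convergence.\<close>

lemma Legendre_P_has_field_derivative:
  "(Legendre_P a has_field_derivative Legendre_P' a z) (at z)"
proof -
  have "((\<lambda>z. eval_fps (legendre_fps a) ((1 - z) / 2)) has_field_derivative
      eval_fps (fps_deriv (legendre_fps a)) ((1 - z) / 2) * (- 1 / 2)) (at z)"
    using legendre_conv_radius
    by (intro DERIV_chain2[OF has_field_derivative_eval_fps]) (auto intro!: derivative_eq_intros)
  then show ?thesis
    by (simp add: Legendre_P_eq[abs_def] Legendre_P'_def)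
qed

lemma Legendre_P'_has_field_derivative:
  "(Legendre_P' a has_field_derivative Legendre_P'' a z) (at z)"
proof -
  have "((\<lambda>z. eval_fps (fps_deriv (legendre_fps a)) ((1 - z) / 2)) has_field_derivative
      eval_fps (fps_deriv (fps_deriv (legendre_fps a))) ((1 - z) / 2) * (- 1 / 2)) (at z)"
    using legendre_conv_radius
    by (intro DERIV_chain2[OF has_field_derivative_eval_fps]) (auto intro!: derivative_eq_intros)
  then show ?thesis
    unfolding Legendre_P'_def[abs_def] Legendre_P''_def
    by (auto intro!: derivative_eq_intros)
qed

lemma isCont_Legendre_P'': "isCont (Legendre_P'' a) z"
proof -
  have "isCont (\<lambda>z. eval_fps (fps_deriv (fps_deriv (legendre_fps a))) ((1 - z) / 2)) z"
    by (rule isCont_o2[where f = "\<lambda>z. (1 - z) / 2"])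
      (use legendre_conv_radius in \<open>auto intro: continuous_eval_fps\<close>)
  then show ?thesis
    unfolding Legendre_P''_def[abs_def] by simp
qed

lemma Legendre_P_ode:
  "(1 - z\<^sup>2) * Legendre_P'' a z - 2 * z * Legendre_P' a z + a * (a + 1) * Legendre_P a z = 0"
proof -
  define x where "x = (1 - z) / 2"
  have "\<bar>x\<bar> < 1" and z: "z = 1 - 2 * x" using z by (simp_all add: x_def field_simps)
  from legendre_ode[OF a this(1)] show ?thesis
    unfolding Legendre_P_eq Legendre_P'_def Legendre_P''_def x_def[symmetric] z
    by (simp add: algebra_simps power2_eq_square)
qed

end

section \<open>The series with the factor a removed, and the choice of the exponent\<close>

lemma norm_legendre_term_le:
  assumes a: "0 \<le> a" "a \<le> 1" and x: "0 \<le> x"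
  shows "norm (legendre_coeff a n * x ^ n) \<le> 2 * x ^ n"
    and "norm ((real n + 1) * legendre_coeff a n * x ^ n) \<le> 2 * (of_nat (Suc n) * x ^ n)"
proof -
  have c: "0 \<le> legendre_coeff a n" "legendre_coeff a n \<le> 2"
    using legendre_coeff_bounds[OF a] by auto
  show "norm (legendre_coeff a n * x ^ n) \<le> 2 * x ^ n"
    using c x by (simp add: abs_mult mult_right_mono)
  have "legendre_coeff a n * (of_nat (Suc n) * x ^ n) \<le> 2 * (of_nat (Suc n) * x ^ n)"
    using c x by (intro mult_right_mono) auto
  then show "norm ((real n + 1) * legendre_coeff a n * x ^ n) \<le> 2 * (of_nat (Suc n) * x ^ n)"
    using c x by (simp add: abs_mult mult_ac add_ac)
qed

lemma summable_legendre_coeff: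
  assumes a: "0 \<le> a" "a \<le> 1" and x: "0 \<le> x" "x < 1"
  shows "summable (\<lambda>n. legendre_coeff a n * x ^ n)"
    and "summable (\<lambda>n. (real n + 1) * legendre_coeff a n * x ^ n)"
proof -
  have g: "summable (\<lambda>n. 2 * x ^ n)" "summable (\<lambda>n. 2 * (of_nat (Suc n) * x ^ n))"
    using x geometric_deriv_sums[of x] by (auto intro!: summable_mult summable_geometric sums_summable)
  show "summable (\<lambda>n. legendre_coeff a n * x ^ n)"
    by (rule summable_comparison_test'[OF g(1), of 0]) (rule norm_legendre_term_le[OF a x(1)])
  show "summable (\<lambda>n. (real n + 1) * legendre_coeff a n * x ^ n)"
    by (rule summable_comparison_test'[OF g(2), of 0]) (rule norm_legendre_term_le[OF a x(1)])
qed

text \<open>By \<open>legendre_fps_nth_Suc_coeff\<close> a factor \<open>- a\<close> comes out of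
  all terms but the constant one. In the derivative it combines with the factor
  \<open>- 1 / 2\<close> from the argument \<open>(1 - z) / 2\<close>.\<close>

lemma legendre_series:
  assumes a: "0 \<le> a" "a \<le> 1" and z: "-1 < z" "z \<le> 1"
  defines "x \<equiv> (1 - z) / 2"
  shows "Legendre_P a z = 1 - a * x * (\<Sum>n. legendre_coeff a n * x ^ n)"
    and "Legendre_P' a z = a / 2 * (\<Sum>n. (real n + 1) * legendre_coeff a n * x ^ n)"
proof -
  note r = legendre_conv_radius[OF a z, folded x_def]
  have x: "0 \<le> x" "x < 1" using z by (simp_all add: x_def)
  have "(\<lambda>n. fps_nth (legendre_fps a) n * x ^ n) sums Legendre_P a z"
    unfolding Legendre_P_eq x_def[symmetric] by (rule sums_eval_fps) (use r in simp)
  moreover have "(\<lambda>n. - a * x * (legendre_coeff a n * x ^ n)) sums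
      (- a * x * (\<Sum>n. legendre_coeff a n * x ^ n))"
    by (intro sums_mult summable_sums summable_legendre_coeff a x)
  then have "(\<lambda>n. fps_nth (legendre_fps a) (Suc n) * x ^ Suc n) sums
      (- a * x * (\<Sum>n. legendre_coeff a n * x ^ n))"
    by (simp add: legendre_fps_nth_Suc_coeff mult_ac)
  then have "(\<lambda>n. fps_nth (legendre_fps a) n * x ^ n) sums
      (- a * x * (\<Sum>n. legendre_coeff a n * x ^ n) + 1)"
    by (subst (asm) sums_Suc_iff) simp
  ultimately show "Legendre_P a z = 1 - a * x * (\<Sum>n. legendre_coeff a n * x ^ n)"
    using sums_unique2 by fastforce
  have "(\<lambda>n. fps_nth (fps_deriv (legendre_fps a)) n * x ^ n) sums (- 2 * Legendre_P' a z)"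
    using sums_eval_fps[of x "fps_deriv (legendre_fps a)"] r
    by (simp add: Legendre_P'_def flip: x_def)
  moreover have "(\<lambda>n. - a * ((real n + 1) * legendre_coeff a n * x ^ n)) sums
      (- a * (\<Sum>n. (real n + 1) * legendre_coeff a n * x ^ n))"
    by (intro sums_mult summable_sums summable_legendre_coeff a x)
  then have "(\<lambda>n. fps_nth (fps_deriv (legendre_fps a)) n * x ^ n) sums
      (- a * (\<Sum>n. (real n + 1) * legendre_coeff a n * x ^ n))"
    by (simp add: legendre_fps_nth_Suc_coeff mult_ac add_ac)
  ultimately have "- 2 * Legendre_P' a z = - a * (\<Sum>n. (real n + 1) * legendre_coeff a n * x ^ n)"
    by (rule sums_unique2)
  then show "Legendre_P' a z = a / 2 * (\<Sum>n. (real n + 1) * legendre_coeff a n * x ^ n)"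
    by simp
qed

text \<open>The majorants of \<open>norm_legendre_term_le\<close> are independent of
  \<open>a\<close>, so the Weierstrass test gives uniform convergence in \<open>a\<close>.\<close>

lemma continuous_on_legendre_series:
  assumes x: "0 \<le> x" "x < 1"
  shows "continuous_on {0..1} (\<lambda>a. \<Sum>n. legendre_coeff a n * x ^ n)"
    and "continuous_on {0..1} (\<lambda>a. \<Sum>n. (real n + 1) * legendre_coeff a n * x ^ n)"
proof -
  have g: "summable (\<lambda>n. 2 * x ^ n)" "summable (\<lambda>n. 2 * (of_nat (Suc n) * x ^ n))"
    using x geometric_deriv_sums[of x] by (auto intro!: summable_mult summable_geometric sums_summable)
  show "continuous_on {0..1} (\<lambda>a. \<Sum>n. legendre_coeff a n * x ^ n)"
  proof (rule uniform_limit_theorem[OF _ Weierstrass_m_test[OF _ g(1)]])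
    show "norm (legendre_coeff a n * x ^ n) \<le> 2 * x ^ n" if "a \<in> {0..1}" for a n
      using that x by (intro norm_legendre_term_le) auto
  qed (auto intro!: always_eventually continuous_intros continuous_on_legendre_coeff)
  show "continuous_on {0..1} (\<lambda>a. \<Sum>n. (real n + 1) * legendre_coeff a n * x ^ n)"
  proof (rule uniform_limit_theorem[OF _ Weierstrass_m_test[OF _ g(2)]])
    show "norm ((real n + 1) * legendre_coeff a n * x ^ n) \<le> 2 * (of_nat (Suc n) * x ^ n)"
      if "a \<in> {0..1}" for a n
      using that x by (intro norm_legendre_term_le) auto
  qed (auto intro!: always_eventually continuous_intros continuous_on_legendre_coeff)
qed

lemma exists_legendre_exponent:
  assumes \<theta>: "0 < \<theta>" "\<theta> < pi" and sgn: "cos (\<theta> / 2 - s) * cos s < 0"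
  shows "\<exists>a\<in>{0<..<1}. a * cos (\<theta> - s) * Legendre_P a (cos \<theta>)
           + sin (\<theta> - s) * sin \<theta> * Legendre_P' a (cos \<theta>) = 0"
proof -
  define x where "x = (1 - cos \<theta>) / 2"
  have c: "-1 < cos \<theta>" "cos \<theta> \<le> 1"
    using cos_monotone_0_pi[of \<theta> pi] \<theta> by simp_all
  then have x: "0 \<le> x" "x < 1" by (simp_all add: x_def)
  define E where "E a = (\<Sum>n. legendre_coeff a n * x ^ n)" for a
  define E' where "E' a = (\<Sum>n. (real n + 1) * legendre_coeff a n * x ^ n)" for a
  define K where "K a = cos (\<theta> - s) * (1 - a * x * E a) + sin (\<theta> - s) * sin \<theta> / 2 * E' a" for a
  have K: "a * cos (\<theta> - s) * Legendre_P a (cos \<theta>)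
           + sin (\<theta> - s) * sin \<theta> * Legendre_P' a (cos \<theta>) = a * K a" if "a \<in> {0..1}" for a
  proof -
    have "Legendre_P a (cos \<theta>) = 1 - a * x * E a" "Legendre_P' a (cos \<theta>) = a / 2 * E' a"
      using that legendre_series[of a "cos \<theta>"] c by (simp_all add: E_def E'_def x_def)
    then show ?thesis unfolding K_def by (simp only:) (simp add: algebra_simps)
  qed
  have cont: "continuous_on {0..1} K"
    unfolding K_def E_def E'_def
    by (intro continuous_intros continuous_on_legendre_series x)
  have cos_half: "cos (\<theta> / 2) > 0" using \<theta> by (intro cos_gt_zero) auto
  \<comment> \<open>At \<open>a = 0\<close> the coefficient is \<open>1 / (real n + 1)\<close> and
    cancels the factor from differentiation, leaving a geometric series.\<close>
  have "E' 0 = (\<Sum>n. x ^ n)"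
    unfolding E'_def by (intro suminf_cong) (simp add: legendre_coeff_at_0)
  also have "\<dots> = 2 / (1 + cos \<theta>)"
    using x by (subst suminf_geometric) (simp_all add: x_def field_simps)
  also have "1 + cos \<theta> = 2 * (cos (\<theta> / 2))\<^sup>2"
    using cos_double_cos[of "\<theta> / 2"] by simp
  finally have E'0: "E' 0 = 1 / (cos (\<theta> / 2))\<^sup>2" by simp
  \<comment> \<open>The factor \<open>sin \<theta> / 2 * E' 0\<close> in \<open>K 0\<close> is the
    tangent of \<open>\<theta> / 2\<close>; multiplying by the cosine of \<open>\<theta> / 2\<close>
    turns \<open>K 0\<close> into an addition formula.\<close>
  have K0: "K 0 * cos (\<theta> / 2) = cos (\<theta> / 2 - s)"
  proof -
    have "cos (\<theta> / 2 - s) = cos ((\<theta> - s) - \<theta> / 2)" by (simp add: algebra_simps)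
    also have "\<dots> = cos (\<theta> - s) * cos (\<theta> / 2) + sin (\<theta> - s) * sin (\<theta> / 2)"
      by (rule cos_diff)
    finally show ?thesis
      using cos_half sin_double[of "\<theta> / 2"]
      by (simp add: K_def E'0 field_simps power2_eq_square)
  qed
  have sums1: "(\<lambda>n. legendre_coeff 1 n * x ^ n) = (\<lambda>n. if n = 0 then 2 else 0)"
    "(\<lambda>n. (real n + 1) * legendre_coeff 1 n * x ^ n) = (\<lambda>n. if n = 0 then 2 else 0)"
    by (auto simp: legendre_coeff_at_1)
  have "(\<Sum>n::nat. if n = 0 then 2 else 0) = (2 :: real)"
    using sums_unique[OF sums_single[of 0 "\<lambda>_. 2 :: real"]] by simp
  then have "E 1 = 2" "E' 1 = 2"
    by (simp_all only: E_def E'_def sums1)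
  \<comment> \<open>Here \<open>1 - 2 * x\<close> is \<open>cos \<theta>\<close>, and again an
    addition formula remains.\<close>
  then have K1: "K 1 = cos s"
    using cos_diff[of "\<theta>" "\<theta> - s"] by (simp add: K_def x_def field_simps)
  have sgn': "K 0 * K 1 < 0"
    using sgn cos_half unfolding K0[symmetric] K1[symmetric]
    by (simp add: mult_less_0_iff zero_less_mult_iff)
  have "\<exists>a. 0 \<le> a \<and> a \<le> 1 \<and> K a = 0"
  proof (cases "K 0 < 0")
    case True
    then show ?thesis using sgn' cont IVT'[of K 0 0 1] by (auto simp: mult_less_0_iff)
  next
    case False
    then show ?thesis using sgn' cont IVT2'[of K 1 0 0] by (auto simp: mult_less_0_iff)
  qed
  then obtain a where a: "0 \<le> a" "a \<le> 1" "K a = 0" by blast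
  \<comment> \<open>The strict sign change excludes both endpoints as zeros of
    \<open>K\<close>.\<close>
  then have "a \<noteq> 0" "a \<noteq> 1" using sgn' by auto
  then show ?thesis using a K[of a] by force
qed

subsection \<open>Homogeneous functions symmetric about an axis\<close>

text \<open>The fractions of \<open>x + y\<close> taken by \<open>x\<close> and by \<open>y\<close>
  lie in [0, 1], where t is at most t^a, and they add up to 1.\<close>

lemma powr_add_le:
  fixes x y a :: real
  assumes "0 \<le> x" "0 \<le> y" "0 \<le> a" "a \<le> 1"
  shows "(x + y) powr a \<le> x powr a + y powr a"
proof (cases "x + y = 0")
  case True
  then show ?thesis by simp
next
  case False
  then have pos: "0 < x + y" using assms by simp
  have "x / (x + y) + y / (x + y) \<le> (x / (x + y)) powr a + (y / (x + y)) powr a"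
    using assms pos powr_mono'[of a 1 "x / (x + y)"] powr_mono'[of a 1 "y / (x + y)"] by simp
  also have "x / (x + y) + y / (x + y) = 1"
    using pos by (simp flip: add_divide_distrib)
  also have "(x / (x + y)) powr a + (y / (x + y)) powr a = (x powr a + y powr a) / (x + y) powr a"
    using assms pos by (simp add: powr_divide add_divide_distrib)
  finally show ?thesis using pos by simp
qed

lemma abs_powr_diff_le:
  fixes x y a :: real
  assumes "0 \<le> x" "0 \<le> y" "0 \<le> a" "a \<le> 1"
  shows "\<bar>x powr a - y powr a\<bar> \<le> \<bar>x - y\<bar> powr a"
proof (cases "x \<le> y")
  case True
  then show ?thesis
    using powr_add_le[of x "y - x" a] powr_mono2[of a x y] assms by (simp add: abs_if)
next
  case False
  then show ?thesis
    using powr_add_le[of y "x - y" a] powr_mono2[of a y x] assms by (simp add: abs_if)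
qed

section \<open>Derivatives of homogeneous zonal functions\<close>

text \<open>Using the cosine \<open>x $ 3 / norm x\<close> as variable avoids differentiating the
  polar angle, which is singular on the axis. As \<open>0 powr k = 0\<close>, the value at the
  vertex is 0.\<close>

definition zonal :: "real \<Rightarrow> (real \<Rightarrow> real) \<Rightarrow> real^3 \<Rightarrow> real" where
  "zonal k H x = norm x powr k * H (x $ 3 / norm x)"

text \<open>With r the norm and z the cosine, D(r^k) = k r^(k-2) x and Dz = e_3 / r - z x / r^2. The
  coefficients of x and e_3 are zonal again, so the Hessian follows by reusing the same
  formula.\<close>

definition zonal_grad :: "real \<Rightarrow> (real \<Rightarrow> real) \<Rightarrow> (real \<Rightarrow> real) \<Rightarrow> real^3 \<Rightarrow> real^3" where
  "zonal_grad k H H' x =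
     zonal (k - 2) (\<lambda>z. k * H z - z * H' z) x *\<^sub>R x + zonal (k - 1) H' x *\<^sub>R axis 3 1"

text \<open>Row i is the gradient of component i of \<open>zonal_grad\<close>, by the product rule;
  \<open>(k - 1) * H' z - z * H'' z\<close> is the derivative of
  \<open>k * H z - z * H' z\<close>.\<close>

definition zonal_hess ::
    "real \<Rightarrow> (real \<Rightarrow> real) \<Rightarrow> (real \<Rightarrow> real) \<Rightarrow> (real \<Rightarrow> real) \<Rightarrow> real^3 \<Rightarrow> real^3^3" where
  "zonal_hess k H H' H'' x = (\<chi> i j.
     zonal_grad (k - 2) (\<lambda>z. k * H z - z * H' z) (\<lambda>z. (k - 1) * H' z - z * H'' z) x $ j * x $ i
     + (if i = j then zonal (k - 2) (\<lambda>z. k * H z - z * H' z) x else 0)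
     + zonal_grad (k - 1) H' H'' x $ j * axis 3 1 $ i)"

lemma of_spherical_eq_zonal: "of_spherical (\<lambda>r \<theta>. r powr k * H (cos \<theta>)) = zonal k H"
proof
  fix x :: "real^3"
  have "\<bar>x $ 3 / norm x\<bar> \<le> 1"
    using component_le_norm_cart[of x 3] by (cases "x = 0") (simp_all add: abs_divide)
  then show "of_spherical (\<lambda>r \<theta>. r powr k * H (cos \<theta>)) x = zonal k H x"
    by (simp add: of_spherical_def zonal_def cos_arccos_abs)
qed

lemma axisymmetric_zonal: "axisymmetric_on S (zonal k H)"
proof -
  have "norm x = sqrt ((y1 x)\<^sup>2 + (y2 x)\<^sup>2)" for x
    by (simp add: norm_vec_def L2_set_def sum_3 y1_def y2_def add_ac)
  then show ?thesis
    unfolding axisymmetric_on_def zonal_def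
    by (intro exI[of _ "\<lambda>p q. sqrt (p\<^sup>2 + q\<^sup>2) powr k * H (p / sqrt (p\<^sup>2 + q\<^sup>2))"]) (simp add: y1_def)
qed

lemma has_derivative_zonal:
  assumes x: "x \<noteq> 0" and H: "(H has_field_derivative H' (x $ 3 / norm x)) (at (x $ 3 / norm x))"
  shows "(zonal k H has_derivative (\<lambda>h. zonal_grad k H H' x \<bullet> h)) (at x)"
proof -
  define r where "r = norm x"
  have r: "0 < r" using x by (simp add: r_def)
  have z: "((\<lambda>x. x $ 3 / norm x) has_derivative (\<lambda>h. h $ 3 / r - x $ 3 * (x \<bullet> h) / r ^ 3)) (at x)"
    using x
    by (auto intro!: derivative_eq_intros has_derivative_norm bounded_linear.has_derivative[OF bounded_linear_vec_nth]
        simp: sgn_div_norm inner_commute field_simps power3_eq_cube r_def)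
  have "((\<lambda>x. H (x $ 3 / norm x)) has_derivative
      (\<lambda>h. H' (x $ 3 / r) * (h $ 3 / r - x $ 3 * (x \<bullet> h) / r ^ 3))) (at x)"
    using has_derivative_compose[OF z H[unfolded has_field_derivative_def]] by (simp add: r_def)
  moreover have "((\<lambda>x. norm x powr k) has_derivative (\<lambda>h. k * r powr (k - 2) * (x \<bullet> h))) (at x)"
    using x
    by (auto intro!: derivative_eq_intros has_derivative_norm
        simp: sgn_div_norm inner_commute r_def powr_diff field_simps power2_eq_square)
  ultimately have "((\<lambda>x. norm x powr k * H (x $ 3 / norm x)) has_derivative
      (\<lambda>h. norm x powr k * (H' (x $ 3 / r) * (h $ 3 / r - x $ 3 * (x \<bullet> h) / r ^ 3))
         + k * r powr (k - 2) * (x \<bullet> h) * H (x $ 3 / norm x))) (at x)"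
    by (intro has_derivative_mult)
  also have "(\<lambda>h. norm x powr k * (H' (x $ 3 / r) * (h $ 3 / r - x $ 3 * (x \<bullet> h) / r ^ 3))
         + k * r powr (k - 2) * (x \<bullet> h) * H (x $ 3 / norm x)) = (\<lambda>h. zonal_grad k H H' x \<bullet> h)"
    using r
    by (simp add: fun_eq_iff zonal_grad_def zonal_def inner_add_left inner_axis' powr_diff
        field_simps power2_eq_square power3_eq_cube flip: r_def)
  finally show ?thesis unfolding zonal_def[abs_def] .
qed

context
  fixes T :: "real set" and H H' H'' :: "real \<Rightarrow> real" and k :: real
  assumes H: "\<And>z. z \<in> T \<Longrightarrow> (H has_field_derivative H' z) (at z)"
    and H': "\<And>z. z \<in> T \<Longrightarrow> (H' has_field_derivative H'' z) (at z)"
begin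

lemma has_derivative_zonal_grad:
  assumes x: "x \<noteq> 0" "x $ 3 / norm x \<in> T"
  shows "(zonal_grad k H H' has_derivative (\<lambda>h. zonal_hess k H H' H'' x *v h)) (at x)"
proof -
  let ?H1 = "\<lambda>z. k * H z - z * H' z" and ?H1' = "\<lambda>z. (k - 1) * H' z - z * H'' z"
  let ?z = "x $ 3 / norm x"
  have "(?H1 has_field_derivative ?H1' ?z) (at ?z)"
    using H[OF x(2)] H'[OF x(2)] by (auto intro!: derivative_eq_intros simp: algebra_simps)
  then have 1: "(zonal (k - 2) ?H1 has_derivative (\<lambda>h. zonal_grad (k - 2) ?H1 ?H1' x \<bullet> h)) (at x)"
    by (intro has_derivative_zonal x)
  have 2: "(zonal (k - 1) H' has_derivative (\<lambda>h. zonal_grad (k - 1) H' H'' x \<bullet> h)) (at x)"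
    by (intro has_derivative_zonal x H')
  have "((\<lambda>x. zonal (k - 2) ?H1 x *\<^sub>R x + zonal (k - 1) H' x *\<^sub>R axis 3 1) has_derivative
     (\<lambda>h. (zonal (k - 2) ?H1 x *\<^sub>R h + (zonal_grad (k - 2) ?H1 ?H1' x \<bullet> h) *\<^sub>R x)
        + (zonal_grad (k - 1) H' H'' x \<bullet> h) *\<^sub>R axis 3 1)) (at x)"
    by (intro has_derivative_add has_derivative_scaleR has_derivative_ident
        bounded_linear.has_derivative[OF bounded_linear_scaleR_left] 1 2)
  also have "(\<lambda>h. (zonal (k - 2) ?H1 x *\<^sub>R h + (zonal_grad (k - 2) ?H1 ?H1' x \<bullet> h) *\<^sub>R x)
        + (zonal_grad (k - 1) H' H'' x \<bullet> h) *\<^sub>R axis 3 1) = (\<lambda>h. zonal_hess k H H' H'' x *v h)"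
    by (simp add: fun_eq_iff vec_eq_iff zonal_hess_def matrix_vector_mult_def inner_vec_def
        forall_3 sum_3 algebra_simps)
  finally show ?thesis unfolding zonal_grad_def[abs_def] .
qed

lemma continuous_on_zonal_hess:
  assumes S: "0 \<notin> S" "\<And>x. x \<in> S \<Longrightarrow> x $ 3 / norm x \<in> T" and cont: "continuous_on T H''"
  shows "continuous_on S (zonal_hess k H H' H'')"
proof -
  have HT: "continuous_on T H" "continuous_on T H'"
    using H H' by (auto intro!: continuous_at_imp_continuous_on DERIV_isCont)
  have zonal: "continuous_on S (zonal l F)" if "continuous_on T F" for l F
    unfolding zonal_def[abs_def]
    by (intro continuous_intros continuous_on_compose2[OF that]) (use S in auto)
  have grad: "continuous_on S (zonal_grad l F F')"
    if "continuous_on T F" "continuous_on T F'" for l F F'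
    unfolding zonal_grad_def[abs_def] by (intro continuous_intros zonal that)
  have H1: "continuous_on T (\<lambda>z. k * H z - z * H' z)"
    "continuous_on T (\<lambda>z. (k - 1) * H' z - z * H'' z)"
    by (intro continuous_intros HT cont)+
  have diag: "continuous_on S (\<lambda>x. if i = j then zonal l F x else 0)"
    if "continuous_on T F" for l F and i j :: 3
    using zonal[OF that] by (cases "i = j") simp_all
  show ?thesis
    unfolding zonal_hess_def[abs_def]
    by (intro continuous_intros continuous_on_vec_lambda zonal grad diag HT H1 cont)
qed

end

section \<open>The cone, the oblique derivative and the Laplacian\<close>

lemma norm_spherical_point: "0 \<le> r \<Longrightarrow> norm (spherical_point r \<theta> \<phi>) = r"
proof -
  assume "0 \<le> r"
  have "(r * sin \<theta> * cos \<phi>)\<^sup>2 + (r * sin \<theta> * sin \<phi>)\<^sup>2 + (r * cos \<theta>)\<^sup>2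
      = r\<^sup>2 * ((sin \<theta>)\<^sup>2 * ((sin \<phi>)\<^sup>2 + (cos \<phi>)\<^sup>2) + (cos \<theta>)\<^sup>2)"
    by (simp only: power_mult_distrib) (simp only: algebra_simps)
  also have "\<dots> = r\<^sup>2" by simp
  finally show ?thesis
    using \<open>0 \<le> r\<close> by (simp add: norm_vec_def L2_set_def sum_3 spherical_point_def)
qed

lemma y2_spherical_point: "0 \<le> r * sin \<theta> \<Longrightarrow> y2 (spherical_point r \<theta> \<phi>) = r * sin \<theta>"
proof -
  assume *: "0 \<le> r * sin \<theta>"
  have "(r * sin \<theta> * cos \<phi>)\<^sup>2 + (r * sin \<theta> * sin \<phi>)\<^sup>2 = (r * sin \<theta>)\<^sup>2 * ((sin \<phi>)\<^sup>2 + (cos \<phi>)\<^sup>2)"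
    by (simp only: power_mult_distrib) (simp only: algebra_simps)
  then show ?thesis using * by (simp add: y2_def spherical_point_def)
qed

lemma spherical_point_3 [simp]: "spherical_point r \<theta> \<phi> $ 3 = r * cos \<theta>"
  by (simp add: spherical_point_def)

lemma cone_cosine:
  assumes "0 < \<theta>0" "\<theta>0 < pi" and x: "x \<in> cone_domain \<theta>0 \<union> cone_boundary \<theta>0"
  shows "x \<noteq> 0" "cos \<theta>0 \<le> x $ 3 / norm x" "x $ 3 / norm x \<le> 1"
proof -
  obtain r \<theta> \<phi> where *: "x = spherical_point r \<theta> \<phi>" "0 < r" "0 \<le> \<theta>" "\<theta> \<le> \<theta>0"
    using x assms unfolding cone_domain_def cone_boundary_def by fastforce
  then have n: "norm x = r" by (simp add: norm_spherical_point)
  then show "x \<noteq> 0" using * by auto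
  show "cos \<theta>0 \<le> x $ 3 / norm x" "x $ 3 / norm x \<le> 1"
    using * n assms cos_monotone_0_pi_le[of \<theta> \<theta>0] by auto
qed

text \<open>The oblique vector has inner product \<open>r * cos (\<theta> - s)\<close> with the
  position and \<open>cos s\<close> with e_3. A positive sine keeps the point off the axis, where
  \<open>oblique_vector\<close> would divide by zero.\<close>

lemma oblique_derivative_zonal_grad:
  assumes "0 < r" "0 < sin \<theta>"
  shows "oblique_vector s (spherical_point r \<theta> \<phi>) \<bullet> zonal_grad k H H' (spherical_point r \<theta> \<phi>) =
    r powr (k - 1) * (k * cos (\<theta> - s) * H (cos \<theta>) + sin (\<theta> - s) * sin \<theta> * H' (cos \<theta>))"
proof -
  let ?x = "spherical_point r \<theta> \<phi>"
  have y2: "y2 ?x = r * sin \<theta>" using assms by (simp add: y2_spherical_point)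
  have "oblique_vector s ?x \<bullet> ?x = sin s * cos \<phi> * (r * sin \<theta> * cos \<phi>)
      + sin s * sin \<phi> * (r * sin \<theta> * sin \<phi>) + cos s * (r * cos \<theta>)"
    using assms unfolding oblique_vector_def y2
    by (simp add: inner_vec_def sum_3 spherical_point_def)
  also have "\<dots> = r * (sin s * sin \<theta> * ((sin \<phi>)\<^sup>2 + (cos \<phi>)\<^sup>2) + cos s * cos \<theta>)"
    by (simp only: algebra_simps power2_eq_square)
  finally have b: "oblique_vector s ?x \<bullet> ?x = r * cos (\<theta> - s)"
    by (simp add: cos_diff algebra_simps)
  have e: "oblique_vector s ?x \<bullet> axis 3 1 = cos s"
    by (simp add: oblique_vector_def inner_axis)
  \<comment> \<open>In this form the first summand cancels the term of \<open>zonal_grad\<close>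
    with \<open>z * H' z\<close>, and the sines remain.\<close>
  have c: "cos s = cos \<theta> * cos (\<theta> - s) + sin \<theta> * sin (\<theta> - s)"
    using cos_diff[of \<theta> "\<theta> - s"] by simp
  show ?thesis
    using assms unfolding zonal_grad_def inner_add_right inner_scaleR_right b e
    by (simp add: zonal_def norm_spherical_point c powr_diff field_simps power2_eq_square)
qed

text \<open>Euler's identity for a homogeneous function of degree \<open>k\<close>.\<close>

lemma zonal_grad_inner_self:
  assumes "x \<noteq> 0"
  shows "zonal_grad k H H' x \<bullet> x = k * zonal k H x"
proof -
  define r where "r = norm x"
  have r: "0 < r" using assms by (simp add: r_def)
  show ?thesis
    using r by (simp add: zonal_grad_def inner_add_left inner_axis' dot_square_norm zonal_def
        powr_diff field_simps power2_eq_square flip: r_def)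
qed

lemma zonal_grad_3:
  assumes "x \<noteq> 0"
  defines "z \<equiv> x $ 3 / norm x"
  shows "zonal_grad k H H' x $ 3 = norm x powr (k - 1) * (k * z * H z + (1 - z\<^sup>2) * H' z)"
proof -
  define r where "r = norm x"
  have r: "0 < r" using assms by (simp add: r_def)
  then have "x $ 3 = r * z" by (simp add: z_def r_def)
  then show ?thesis
    using r by (simp add: zonal_grad_def zonal_def axis_def powr_diff field_simps power2_eq_square
        flip: r_def)
qed

text \<open>The three summands of the Hessian contribute an Euler term of degree
  \<open>k - 2\<close>, three times the diagonal entry, and an axial derivative. The sum is the
  Legendre operator applied to \<open>H\<close>.\<close>

lemma trace_zonal_hess:
  assumes "x \<noteq> 0"
  defines "z \<equiv> x $ 3 / norm x"
  shows "trace (zonal_hess k H H' H'' x) =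
    norm x powr (k - 2) * ((1 - z\<^sup>2) * H'' z - 2 * z * H' z + k * (k + 1) * H z)"
proof -
  let ?H1 = "\<lambda>z. k * H z - z * H' z" and ?H1' = "\<lambda>z. (k - 1) * H' z - z * H'' z"
  have "trace (zonal_hess k H H' H'' x) =
     zonal_grad (k - 2) ?H1 ?H1' x \<bullet> x + 3 * zonal (k - 2) ?H1 x + zonal_grad (k - 1) H' H'' x $ 3"
    by (simp add: trace_def zonal_hess_def sum_3 inner_vec_def axis_def)
  also have "\<dots> = (k - 2) * zonal (k - 2) ?H1 x + 3 * zonal (k - 2) ?H1 x
     + norm x powr (k - 2) * ((k - 1) * z * H' z + (1 - z\<^sup>2) * H'' z)"
    using assms(1) by (simp add: zonal_grad_inner_self zonal_grad_3 flip: z_def)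
  finally show ?thesis
    by (simp add: zonal_def algebra_simps flip: z_def)
qed

lemma oblique_harmonic_zonal:
  assumes \<theta>0: "0 < \<theta>0" "\<theta>0 < pi"
    and H: "\<And>z. z \<in> {-1<..1} \<Longrightarrow> (H has_field_derivative H' z) (at z)"
    and H': "\<And>z. z \<in> {-1<..1} \<Longrightarrow> (H' has_field_derivative H'' z) (at z)"
    and H'': "continuous_on {-1<..1} H''"
    and ode: "\<And>z. z \<in> {-1<..1} \<Longrightarrow>
      (1 - z\<^sup>2) * H'' z - 2 * z * H' z + k * (k + 1) * H z = 0"
    and bdry: "k * cos (\<theta>0 - s) * H (cos \<theta>0) + sin (\<theta>0 - s) * sin \<theta>0 * H' (cos \<theta>0) = 0"
  shows "oblique_harmonic (cone_domain \<theta>0) (cone_boundary \<theta>0) (oblique_vector s) (zonal k H)"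
proof -
  let ?S = "cone_domain \<theta>0 \<union> cone_boundary \<theta>0"
  have x: "x \<noteq> 0" "x $ 3 / norm x \<in> {-1<..1}" if "x \<in> ?S" for x
  proof -
    have "-1 < cos \<theta>0" using cos_monotone_0_pi[of \<theta>0 pi] \<theta>0 by simp
    then show "x \<noteq> 0" "x $ 3 / norm x \<in> {-1<..1}"
      using cone_cosine[OF \<theta>0 that] unfolding greaterThanAtMost_iff by (blast intro: less_le_trans)+
  qed
  have hess: "(zonal_grad k H H' has_derivative (\<lambda>h. zonal_hess k H H' H'' x *v h)) (at x)"
    if "x \<in> ?S" for x
    by (rule has_derivative_zonal_grad[where T = "{-1<..1}"]) (erule H H' | rule x[OF that])+
  show ?thesis
    unfolding oblique_harmonic_def
  proof (intro exI[of _ "zonal_grad k H H'"] exI[of _ "zonal_hess k H H' H''"] conjI ballI)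
    \<comment> \<open>All cosines on the cone and its boundary lie in (-1, 1], where
      \<open>H\<close> has two-sided derivatives, so the gradient on the boundary is the restriction
      of a full derivative.\<close>
    show "(zonal k H has_derivative (\<lambda>h. zonal_grad k H H' x \<bullet> h)) (at x within ?S)"
      if "x \<in> ?S" for x
      by (rule has_derivative_at_withinI) (intro has_derivative_zonal H x that)
    show "continuous_on ?S (zonal_grad k H H')"
      by (intro continuous_at_imp_continuous_on ballI has_derivative_continuous[OF hess])
    show "(zonal_grad k H H' has_derivative (\<lambda>h. zonal_hess k H H' H'' x *v h)) (at x)"
      if "x \<in> cone_domain \<theta>0" for x
      using that by (intro hess) blast
    show "continuous_on (cone_domain \<theta>0) (zonal_hess k H H' H'')"
    proof (rule continuous_on_zonal_hess[where T = "{-1<..1}"])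
      show "0 \<notin> cone_domain \<theta>0" using x(1)[of 0] by blast
      show "x $ 3 / norm x \<in> {-1<..1}" if "x \<in> cone_domain \<theta>0" for x
        using that by (intro x) blast
    qed (erule H H' | rule H'')+
    show "trace (zonal_hess k H H' H'' x) = 0" if "x \<in> cone_domain \<theta>0" for x
    proof -
      have "x \<in> ?S" using that by blast
      then show ?thesis by (simp add: trace_zonal_hess[OF x(1)] ode[OF x(2)] del: times_divide_eq_right)
    qed
    show "oblique_vector s x \<bullet> zonal_grad k H H' x = 0" if on_bdry: "x \<in> cone_boundary \<theta>0" for x
    proof -
      obtain r \<phi> where *: "x = spherical_point r \<theta>0 \<phi>" "0 < r"
        using on_bdry unfolding cone_boundary_def by blast
      have "0 < sin \<theta>0" using \<theta>0 by (rule sin_gt_zero)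
      from oblique_derivative_zonal_grad[OF *(2) this] show ?thesis
        by (simp only: *(1) bdry mult_zero_right)
    qed
  qed
qed

section \<open>The exact Hoelder exponent at the vertex\<close>

lemma norm_axis_real: "norm (axis i t :: real^'n) = \<bar>t\<bar>"
  by (simp add: norm_eq_sqrt_inner inner_axis_axis)

text \<open>The difference splits into a change of length and a change of the third component, each
  at most \<open>norm (x - y) / norm y\<close>. Only \<open>y\<close> has to be nonzero, so
  \<open>x\<close> may be the vertex.\<close>

lemma abs_diff_cosine_le:
  fixes x y :: "real^3"
  assumes "y \<noteq> 0"
  shows "\<bar>x $ 3 / norm x - y $ 3 / norm y\<bar> \<le> 2 * (norm (x - y) / norm y)"
proof (cases "x = 0")
  case True
  have "\<bar>y $ 3\<bar> / norm y \<le> 1"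
    using component_le_norm_cart[of y 3] assms by simp
  then have "\<bar>y $ 3\<bar> / norm y \<le> 2" by linarith
  then show ?thesis using True assms by (simp add: abs_divide)
next
  case False
  have "x $ 3 / norm x - y $ 3 / norm y
      = (x $ 3 / norm x) * ((norm y - norm x) / norm y) + (x - y) $ 3 / norm y"
    using False assms by (simp add: field_simps)
  also have "\<bar>\<dots>\<bar> \<le> \<bar>x $ 3 / norm x\<bar> * \<bar>(norm y - norm x) / norm y\<bar> + \<bar>(x - y) $ 3\<bar> / norm y"
    by (rule order_trans[OF abs_triangle_ineq]) (simp add: abs_mult abs_divide)
  also have "\<dots> \<le> 1 * (norm (x - y) / norm y) + norm (x - y) / norm y"
    using component_le_norm_cart[of x 3] component_le_norm_cart[of "x - y" 3]
      norm_triangle_ineq3[of x y] False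
    by (intro add_mono mult_mono) (auto simp: abs_divide divide_right_mono norm_minus_commute)
  finally show ?thesis by simp
qed

text \<open>The difference is split into a radial part, controlled by
  \<open>abs_powr_diff_le\<close> and a bound for \<open>H\<close>, and an angular part, controlled
  by the Lipschitz constant; in the latter the weight \<open>norm y powr a\<close> absorbs the
  denominator of \<open>abs_diff_cosine_le\<close>.\<close>

lemma holder_on_zonal:
  assumes a: "0 < a" "a \<le> 1" and H: "L-lipschitz_on {c..1} H"
    and S: "\<And>x. x \<in> S \<Longrightarrow> c \<le> x $ 3 / norm x"
  shows "holder_on a S (zonal a H)"
proof -
  have L: "0 \<le> L" using H by (rule lipschitz_on_nonneg)
  obtain M where M: "\<bar>H z\<bar> \<le> M" if "z \<in> {c..1}" for z
  proof -
    have "bounded (H ` {c..1})"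
      by (intro compact_imp_bounded compact_continuous_image lipschitz_on_continuous_on[OF H] compact_Icc)
    then show ?thesis using that unfolding bounded_iff by fastforce
  qed
  have "\<bar>zonal a H x - zonal a H y\<bar> \<le> (M + 2 * L) * dist x y powr a" if "x \<in> S" "y \<in> S" for x y
  proof -
    define p q where "p = x $ 3 / norm x" and "q = y $ 3 / norm y"
    have le1: "\<bar>v $ 3 / norm v\<bar> \<le> 1" for v :: "real^3"
      using component_le_norm_cart[of v 3] by (cases "v = 0") (simp_all add: abs_divide)
    have pq: "p \<in> {c..1}" "q \<in> {c..1}" "\<bar>p\<bar> \<le> 1" "\<bar>q\<bar> \<le> 1"
      using S that le1[of x] le1[of y] unfolding p_def q_def atLeastAtMost_iff abs_le_iff by blast+
    have "\<bar>zonal a H x - zonal a H y\<bar> =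
        \<bar>(norm x powr a - norm y powr a) * H p + norm y powr a * (H p - H q)\<bar>"
      by (simp add: zonal_def p_def q_def algebra_simps)
    also have "\<dots> \<le> \<bar>norm x powr a - norm y powr a\<bar> * \<bar>H p\<bar> + norm y powr a * \<bar>H p - H q\<bar>"
      by (rule order_trans[OF abs_triangle_ineq]) (simp add: abs_mult)
    also have "\<dots> \<le> dist x y powr a * M + 2 * L * dist x y powr a"
    proof (intro add_mono)
      have "\<bar>norm x powr a - norm y powr a\<bar> \<le> \<bar>norm x - norm y\<bar> powr a"
        using a by (intro abs_powr_diff_le) auto
      also have "\<dots> \<le> dist x y powr a"
        using a norm_triangle_ineq3[of x y] by (intro powr_mono2) (auto simp: dist_norm)
      finally show "\<bar>norm x powr a - norm y powr a\<bar> * \<bar>H p\<bar> \<le> dist x y powr a * M"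
        using M[OF pq(1)] by (intro mult_mono) auto
      show "norm y powr a * \<bar>H p - H q\<bar> \<le> 2 * L * dist x y powr a"
      proof (cases "y = 0")
        case True
        then show ?thesis using L by simp
      next
        case False
        \<comment> \<open>For \<open>t\<close> at most 1 the linear bound \<open>2 * t\<close>
          improves to \<open>2 * t powr a\<close>; for larger \<open>t\<close> the trivial bound 2
          on a difference of cosines suffices.\<close>
        define t where "t = norm (x - y) / norm y"
        have t: "0 \<le> t" by (simp add: t_def)
        have "\<bar>p - q\<bar> \<le> 2 * t powr a"
        proof (cases "t \<le> 1")
          case True
          then have "t \<le> t powr a" using powr_mono'[of a 1 t] a t by simp
          then show ?thesis
            using abs_diff_cosine_le[OF False, of x] by (simp add: p_def q_def t_def)
        next
          case False
          then have "1 \<le> t powr a" using a by (simp add: ge_one_powr_ge_zero)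
          then show ?thesis using pq by auto
        qed
        then have "L * \<bar>p - q\<bar> \<le> L * (2 * t powr a)"
          using L by (rule mult_left_mono)
        then have "\<bar>H p - H q\<bar> \<le> L * (2 * t powr a)"
          using lipschitz_onD[OF H pq(1,2)] by (simp add: dist_real_def)
        then have "norm y powr a * \<bar>H p - H q\<bar> \<le> norm y powr a * (L * (2 * t powr a))"
          by (intro mult_left_mono) auto
        also have "\<dots> = 2 * L * (norm y * t) powr a"
          using t by (simp add: powr_mult)
        also have "norm y * t = dist x y" using False by (simp add: t_def dist_norm)
        finally show ?thesis .
      qed
    qed
    finally show ?thesis by (simp add: algebra_simps)
  qed
  then show ?thesis unfolding holder_on_def by blast
qed

text \<open>Comparing the vertex, where the function is 0, with the axis point at height t, where it
  is t^a, would force 1 \<le> C t^\<epsilon>; letting t tend to 0 gives a contradiction.\<close>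

lemma not_holder_on_zonal:
  assumes a: "0 < a" "0 < \<epsilon>" "H 1 = 1" "0 < R"
    and S: "0 \<in> S" "\<And>t. 0 < t \<Longrightarrow> t \<le> R \<Longrightarrow> axis 3 t \<in> S"
  shows "\<not> holder_on (a + \<epsilon>) S (zonal a H)"
proof
  assume "holder_on (a + \<epsilon>) S (zonal a H)"
  then obtain C where C: "\<And>x y. x \<in> S \<Longrightarrow> y \<in> S \<Longrightarrow>
      \<bar>zonal a H x - zonal a H y\<bar> \<le> C * dist x y powr (a + \<epsilon>)"
    unfolding holder_on_def by blast
  have le: "1 \<le> C * t powr \<epsilon>" if t: "0 < t" "t \<le> R" for t
  proof -
    have "t powr a \<le> C * t powr (a + \<epsilon>)"
      using C[OF S(2)[OF t] S(1)] a t by (simp add: zonal_def norm_axis_real)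
    then show ?thesis using t by (simp add: powr_add)
  qed
  have "((\<lambda>t. C * t powr \<epsilon>) \<longlongrightarrow> C * 0 powr \<epsilon>) (at_right 0)"
    using a by (intro tendsto_intros tendsto_powr') (auto intro: eventually_mono[OF eventually_at_right_less])
  moreover have "\<forall>\<^sub>F t in at_right 0. 1 \<le> C * t powr \<epsilon>"
    using le \<open>0 < R\<close> unfolding eventually_at_right_field by (auto intro!: exI[of _ R])
  ultimately have "1 \<le> C * 0 powr \<epsilon>"
    by (rule tendsto_lowerbound) simp
  then show False by simp
qed

text \<open>Clearing the denominator makes the bound on the cosine a closed condition that includes
  the vertex.\<close>

lemma closure_cone_domain_subset:
  assumes "0 < \<theta>0" "\<theta>0 < pi"
  shows "closure (cone_domain \<theta>0) \<subseteq> {x. cos \<theta>0 * norm x \<le> x $ 3}"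
proof (rule closure_minimal)
  show "cone_domain \<theta>0 \<subseteq> {x. cos \<theta>0 * norm x \<le> x $ 3}"
    using cone_cosine[OF assms] by (auto simp: field_simps)
  show "closed {x :: real^3. cos \<theta>0 * norm x \<le> x $ 3}"
    by (intro closed_Collect_le continuous_intros)
qed

lemma axis_in_cone_domain:
  assumes "0 < \<theta>0" "0 < t"
  shows "axis 3 t \<in> cone_domain \<theta>0"
proof -
  have "axis 3 t = spherical_point t 0 0"
    by (simp add: spherical_point_def vec_eq_iff forall_3 axis_def)
  then show ?thesis
    using assms unfolding cone_domain_def by force
qed

lemma zero_in_closure_cone_domain:
  assumes "0 < \<theta>0"
  shows "0 \<in> closure (cone_domain \<theta>0)"
  unfolding closure_approachable
proof (intro allI impI)
  fix e :: real assume "0 < e"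
  then show "\<exists>y\<in>cone_domain \<theta>0. dist y 0 < e"
    using axis_in_cone_domain[OF assms, of "e / 2"]
    by (intro bexI[of _ "axis 3 (e / 2)"]) (auto simp: norm_axis_real)
qed

text \<open>The cosines in the closed cone stay above some c > -1, so one Lipschitz constant serves
  for the Hoelder bound. The vertex and the axis lie in the closure, which gives sharpness.\<close>

lemma sharp_holder_zonal:
  assumes \<theta>0: "0 < \<theta>0" "\<theta>0 < pi" and a: "0 < a" "a \<le> 1"
    and H: "\<And>c. -1 < c \<Longrightarrow> \<exists>L. L-lipschitz_on {c..1} H" and "H 1 = 1"
  shows "sharp_holder_at_vertex a (closure (cone_domain \<theta>0)) (zonal a H)"
  unfolding sharp_holder_at_vertex_def
proof (intro allI impI conjI)
  fix R :: real assume R: "0 < R"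
  let ?S = "closure (cone_domain \<theta>0) \<inter> cball 0 R"
  \<comment> \<open>not \<open>cos \<theta>0\<close>: at the vertex the quotient \<open>x $ 3 / norm x\<close> has the junk value 0\<close>
  define c where "c = - \<bar>cos \<theta>0\<bar>"
  have "-1 < cos \<theta>0" "cos \<theta>0 < 1"
    using cos_monotone_0_pi[of \<theta>0 pi] cos_monotone_0_pi[of 0 \<theta>0] \<theta>0 by simp_all
  then have "-1 < c" by (simp add: c_def abs_if)
  then obtain L where "L-lipschitz_on {c..1} H" using H by blast
  moreover have "c \<le> x $ 3 / norm x" if "x \<in> ?S" for x
  proof (cases "x = 0")
    case False
    then have "cos \<theta>0 \<le> x $ 3 / norm x"
      using that closure_cone_domain_subset[OF \<theta>0] by (auto simp: field_simps)
    then show ?thesis by (simp add: c_def)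
  qed (simp add: c_def)
  ultimately show "holder_on a ?S (zonal a H)"
    using a by (intro holder_on_zonal[of a L c]) auto
  fix \<epsilon> :: real assume "0 < \<epsilon>"
  then show "\<not> holder_on (a + \<epsilon>) ?S (zonal a H)"
    using a assms(6) R zero_in_closure_cone_domain[OF \<theta>0(1)] axis_in_cone_domain[OF \<theta>0(1)]
      closure_subset[of "cone_domain \<theta>0"]
    by (intro not_holder_on_zonal[of _ _ _ R]) (auto simp: norm_axis_real)
qed

subsection \<open>Sharp solutions in the cone\<close>

lemma lipschitz_on_Legendre_P:
  assumes a: "0 \<le> a" "a \<le> 1" and c: "-1 < c"
  shows "\<exists>L. L-lipschitz_on {c..1} (Legendre_P a)"
proof -
  have "continuous_on {c..1} (Legendre_P' a)"
    using a c by (intro continuous_at_imp_continuous_on ballI DERIV_isCont)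
      (rule Legendre_P'_has_field_derivative, auto)
  then have "bounded (Legendre_P' a ` {c..1})"
    by (intro compact_imp_bounded compact_continuous_image compact_Icc)
  then obtain B where B: "\<And>z. z \<in> {c..1} \<Longrightarrow> norm (Legendre_P' a z) \<le> B"
    unfolding bounded_iff by blast
  have "\<bar>Legendre_P a x - Legendre_P a y\<bar> \<le> \<bar>B\<bar> * \<bar>x - y\<bar>" if "x \<in> {c..1}" "y \<in> {c..1}" for x y
  proof -
    have "norm (Legendre_P a x - Legendre_P a y) \<le> \<bar>B\<bar> * norm (x - y)"
    proof (rule field_differentiable_bound[OF convex_real_interval(5)[of c 1] _ _ that])
      show "(Legendre_P a has_field_derivative Legendre_P' a z) (at z within {c..1})"
        if "z \<in> {c..1}" for z
        using that a c
        by (intro has_field_derivative_at_within[OF Legendre_P_has_field_derivative]) auto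
      show "norm (Legendre_P' a z) \<le> \<bar>B\<bar>" if "z \<in> {c..1}" for z
        using B[OF that] by linarith
    qed
    then show ?thesis by simp
  qed
  then have "\<bar>B\<bar>-lipschitz_on {c..1} (Legendre_P a)"
    by (intro lipschitz_onI) (auto simp: dist_real_def)
  then show ?thesis by blast
qed

lemma exists_sharp_axisymmetric_solution:
  assumes \<theta>0: "0 < \<theta>0" "\<theta>0 < pi" and sgn: "cos (\<theta>0 / 2 - s) * cos s < 0"
  shows "\<exists>\<alpha>\<in>{0<..<1}. sharp_axisymmetric_solution \<theta>0 s \<alpha>
           (of_spherical (\<lambda>r \<theta>. r powr \<alpha> * Legendre_P \<alpha> (cos \<theta>)))"
proof -
  obtain a where a: "a \<in> {0<..<1}" and bdry: "a * cos (\<theta>0 - s) * Legendre_P a (cos \<theta>0)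
      + sin (\<theta>0 - s) * sin \<theta>0 * Legendre_P' a (cos \<theta>0) = 0"
    using exists_legendre_exponent[OF assms] by blast
  have a01: "0 \<le> a" "a \<le> 1" using a by auto
  have "oblique_harmonic (cone_domain \<theta>0) (cone_boundary \<theta>0) (oblique_vector s)
      (zonal a (Legendre_P a))"
    using \<theta>0
  proof (rule oblique_harmonic_zonal[where H' = "Legendre_P' a" and H'' = "Legendre_P'' a"])
    fix z :: real assume "z \<in> {-1<..1}"
    then have z: "-1 < z" "z \<le> 1" by auto
    show "(Legendre_P a has_field_derivative Legendre_P' a z) (at z)"
      by (rule Legendre_P_has_field_derivative[OF a01 z])
    show "(Legendre_P' a has_field_derivative Legendre_P'' a z) (at z)"
      by (rule Legendre_P'_has_field_derivative[OF a01 z])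
    show "(1 - z\<^sup>2) * Legendre_P'' a z - 2 * z * Legendre_P' a z + a * (a + 1) * Legendre_P a z = 0"
      by (rule Legendre_P_ode[OF a01 z])
  next
    show "continuous_on {-1<..1} (Legendre_P'' a)"
      by (rule continuous_at_imp_continuous_on) (auto intro: isCont_Legendre_P'' a01)
  qed (rule bdry)
  moreover have "sharp_holder_at_vertex a (closure (cone_domain \<theta>0)) (zonal a (Legendre_P a))"
    using \<theta>0 a by (intro sharp_holder_zonal lipschitz_on_Legendre_P) auto
  ultimately have "sharp_axisymmetric_solution \<theta>0 s a
      (of_spherical (\<lambda>r \<theta>. r powr a * Legendre_P a (cos \<theta>)))"
    unfolding sharp_axisymmetric_solution_def of_spherical_eq_zonal
    using axisymmetric_zonal by blast
  then show ?thesis using a by blast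
qed

theorem theorem6p1:
  fixes \<theta>0 :: real
  assumes "0 < \<theta>0" and "\<theta>0 < pi"
  shows
    "(\<theta>0 \<in> {pi / 2 <..< pi} \<longrightarrow>
       (\<exists>s0 \<in> {- pi + \<theta>0 <..< 0}.
          \<forall>s \<in> {- pi + \<theta>0 <..< \<theta>0}.
            s \<in> {- pi + \<theta>0 <..< s0} \<or> s \<in> {pi / 2 <..< \<theta>0} \<longrightarrow>
            (\<exists>\<alpha> \<in> {0 <..< 1}.
               sharp_axisymmetric_solution \<theta>0 s \<alpha>
                 (of_spherical (\<lambda>r \<theta>. r powr \<alpha> * Legendre_P \<alpha> (cos \<theta>)))))) \<and>
     (\<theta>0 \<in> {0 <..< pi / 2} \<longrightarrow>
       (\<exists>s0 \<in> {- (pi / 2) <..< 0}.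
          \<forall>s \<in> {- pi + \<theta>0 <..< \<theta>0}.
            s \<in> {- (pi / 2) <..< s0} \<longrightarrow>
            (\<exists>\<alpha> \<in> {0 <..< 1}.
               sharp_axisymmetric_solution \<theta>0 s \<alpha>
                 (of_spherical (\<lambda>r \<theta>. r powr \<alpha> * Legendre_P \<alpha> (cos \<theta>))))))"
proof -
  \<comment> \<open>At this \<open>s\<close> the angle \<open>\<theta>0 / 2 - s\<close> equals
    \<open>pi / 2\<close>, so the value at degree 0 changes sign there.\<close>
  let ?s0 = "\<theta>0 / 2 - pi / 2"
  have neg: "cos x < 0" if "pi / 2 < x" "x < pi" for x :: real
    using cos_monotone_0_pi[of "pi / 2" x] that by simp
  \<comment> \<open>Here \<open>\<theta>0 / 2 - s\<close> lies between \<open>pi / 2\<close> and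
    \<open>pi\<close>, the upper bound using \<open>\<theta>0 < pi\<close>, while
    \<open>cos s\<close> is positive.\<close>
  have small: "cos (\<theta>0 / 2 - s) * cos s < 0" if "- (pi / 2) < s" "s < ?s0" for s
    using that assms neg[of "\<theta>0 / 2 - s"] cos_gt_zero_pi[of s] by (simp add: mult_neg_pos)
  \<comment> \<open>Now \<open>cos s\<close> is negative, and \<open>\<theta>0 / 2 - s\<close> lies
    between \<open>- (pi / 2)\<close> and 0.\<close>
  have large: "cos (\<theta>0 / 2 - s) * cos s < 0" if "pi / 2 < s" "s < \<theta>0" for s
    using that assms neg[of s] cos_gt_zero_pi[of "\<theta>0 / 2 - s"] by (simp add: mult_pos_neg)
  show ?thesis
  proof (intro conjI impI)
    \<comment> \<open>For these angles \<open>- pi + \<theta>0\<close> exceeds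
      \<open>- (pi / 2)\<close>, so \<open>small\<close> covers the whole range below
      \<open>?s0\<close>.\<close>
    assume "\<theta>0 \<in> {pi / 2<..<pi}"
    then show "\<exists>s0\<in>{- pi + \<theta>0<..<0}. \<forall>s\<in>{- pi + \<theta>0<..<\<theta>0}.
        s \<in> {- pi + \<theta>0<..<s0} \<or> s \<in> {pi / 2<..<\<theta>0} \<longrightarrow>
        (\<exists>\<alpha>\<in>{0<..<1}. sharp_axisymmetric_solution \<theta>0 s \<alpha>
           (of_spherical (\<lambda>r \<theta>. r powr \<alpha> * Legendre_P \<alpha> (cos \<theta>))))"
      by (intro bexI[of _ ?s0] ballI impI exists_sharp_axisymmetric_solution assms)
        (auto intro: small large)
  next
    assume "\<theta>0 \<in> {0<..<pi / 2}"
    then show "\<exists>s0\<in>{- (pi / 2)<..<0}. \<forall>s\<in>{- pi + \<theta>0<..<\<theta>0}.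
        s \<in> {- (pi / 2)<..<s0} \<longrightarrow>
        (\<exists>\<alpha>\<in>{0<..<1}. sharp_axisymmetric_solution \<theta>0 s \<alpha>
           (of_spherical (\<lambda>r \<theta>. r powr \<alpha> * Legendre_P \<alpha> (cos \<theta>))))"
      by (intro bexI[of _ ?s0] ballI impI exists_sharp_axisymmetric_solution assms)
        (auto intro: small)
  qed
qed

end
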